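(* With the notation of the context, the entries of the last column of $\mathbf{M}_{\mathrm{Green}}^{(2n)}$ can be written, for $1\le i\le 2n$, in the form $$\left(\mathbf{M}_{\mathrm{Green}}^{(2n)}\right)_{i,2n}=(-1)^{i+1}\left(\prod_{\ell=\lfloor\frac{i+2}{2}\rfloor}^{n}\frac{\sqrt{1-q_\ell^2}}{(1+q_\ell Q_{\ell-1})\sqrt{\sigma_{\ell-1}}}\right)\times\begin{cases}\sigma_{\frac i2}Q_{\frac i2}& i\text{ even},\\ \sqrt{\sigma_{\frac{i-1}{2}}}& i\text{ odd}.\end{cases}$$ For the modulus of the entries of the odd rows it holds $$\left|\left(\mathbf{M}_{\mathrm{Green}}^{(2n)}\right)_{2n-2m+1,2n}\right|=\left|\prod_{\ell=n-m+1}^{n}\frac{\sqrt{1-q_\ell^2}}{1+q_\ell Q_{\ell-1}}\right|,\qquad1\le m\le n,$$ and for the even rows $$\left|\left(\mathbf{M}_{\mathrm{Green}}^{(2n)}\right)_{2n,2n}\right|=|Q_n|,$$ $$\left|\left(\mathbf{M}_{\mathrm{Green}}^{(2n)}\right)_{2n-2m,2n}\right|=\left|\left(\mathbf{M}_{\mathrm{Green}}^{(2n)}\right)_{2n-2m+1,2n}\right|\,|Q_{n-m}|,\qquad1\le m\le n-1.$$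
   Context: Let $n\ge 2$, $-1=x_0<x_1<\dots<x_{n+1}=1$, $h_j=x_j-x_{j-1}$, $c_j>0$ for $1\le j\le n+1$, and $\omega\ge\omega_0>0$. Define $q_j:=\frac{c_{j+1}-c_j}{c_{j+1}+c_j}\in(-1,1)$ ($1\le j\le n$), $\sigma_j:=\exp\left(-2\mathrm{i}\frac{h_{j+1}\omega}{c_{j+1}}\right)$ and $\sqrt{\sigma_j}:=\exp\left(-\mathrm{i}\frac{h_{j+1}\omega}{c_{j+1}}\right)$ ($0\le j\le n$). $\mathbf{M}^{(2n)}\in\mathbb{C}^{2n\times2n}$ is the block tridiagonal matrix, with $n\times n$ blocks of size $2\times2$, with diagonal blocks $\mathbf{W}^{(j)}$ ($1\le j\le n$), block $(j,j+1)$ equal to $\mathbf{N}^{(j)}$ and block $(j+1,j)$ equal to $(\mathbf{N}^{(j)})^\intercal$ ($1\le j\le n-1$), all other blocks zero, where $$\mathbf{W}^{(j)}:=\begin{bmatrix}q_j&\sqrt{1-q_j^2}\\ \sqrt{1-q_j^2}&-q_j\end{bmatrix},\qquad\mathbf{N}^{(j)}:=\begin{bmatrix}0&0\\-\frac{1}{\sqrt{\sigma_j}}&0\end{bmatrix},$$ and $\mathbf{M}_{\mathrm{Green}}^{(2n)}:=(\mathbf{M}^{(2n)})^{-1}$ (the matrix is invertible). The sequence $Q_j$ is defined by $Q_0=0$, $Q_1=\frac{q_1}{\sigma_1}$ and $Q_j=\frac{q_j+Q_{j-1}}{\sigma_j(1+q_jQ_{j-1})}$ for $2\le j\le n$ (one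 has $|Q_j|<1$). Empty products equal $1$. *)

theory Defs
  imports Complex_Main "Jordan_Normal_Form.Gauss_Jordan_Elimination"
    "Jordan_Normal_Form.Determinant"
begin

definition step :: "(nat \<Rightarrow> real) \<Rightarrow> nat \<Rightarrow> real" where
  "step x j = x j - x (j - 1)"

definition q_coeff :: "(nat \<Rightarrow> real) \<Rightarrow> nat \<Rightarrow> real" where
  "q_coeff c j = (c (j + 1) - c j) / (c (j + 1) + c j)"

definition sigma :: "(nat \<Rightarrow> real) \<Rightarrow> (nat \<Rightarrow> real) \<Rightarrow> real \<Rightarrow> nat \<Rightarrow> complex" where
  "sigma x c \<omega> j = exp (- 2 * \<i> * complex_of_real (step x (j + 1) * \<omega> / c (j + 1)))"

text \<open>This particular square root of \<open>sigma\<close> is in general not the principal one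
  (\<open>csqrt\<close>).\<close>

definition sqrt_sigma :: "(nat \<Rightarrow> real) \<Rightarrow> (nat \<Rightarrow> real) \<Rightarrow> real \<Rightarrow> nat \<Rightarrow> complex" where
  "sqrt_sigma x c \<omega> j = exp (- \<i> * complex_of_real (step x (j + 1) * \<omega> / c (j + 1)))"

definition W_block :: "(nat \<Rightarrow> real) \<Rightarrow> nat \<Rightarrow> complex mat" where
  "W_block c j = mat_of_rows_list 2
     [[complex_of_real (q_coeff c j), complex_of_real (sqrt (1 - (q_coeff c j)\<^sup>2))],
      [complex_of_real (sqrt (1 - (q_coeff c j)\<^sup>2)), - complex_of_real (q_coeff c j)]]"

definition N_block :: "(nat \<Rightarrow> real) \<Rightarrow> (nat \<Rightarrow> real) \<Rightarrow> real \<Rightarrow> nat \<Rightarrow> complex mat" where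
  "N_block x c \<omega> j = mat_of_rows_list 2 [[0, 0], [- (1 / sqrt_sigma x c \<omega> j), 0]]"

text \<open>Blocks are numbered from 1. Matrix entries are numbered from 0, so that row \<open>r\<close> is
  row \<open>r mod 2\<close> of block row \<open>r div 2 + 1\<close>.\<close>

definition M_block ::
    "(nat \<Rightarrow> real) \<Rightarrow> (nat \<Rightarrow> real) \<Rightarrow> real \<Rightarrow> nat \<Rightarrow> nat \<Rightarrow> complex mat" where
  "M_block x c \<omega> j k =
     (if k = j then W_block c j
      else if k = j + 1 then N_block x c \<omega> j
      else if j = k + 1 then transpose_mat (N_block x c \<omega> k)
      else 0\<^sub>m 2 2)"

definition M_mat ::
    "nat \<Rightarrow> (nat \<Rightarrow> real) \<Rightarrow> (nat \<Rightarrow> real) \<Rightarrow> real \<Rightarrow> complex mat" where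
  "M_mat n x c \<omega> = mat (2 * n) (2 * n)
     (\<lambda>(r, s). M_block x c \<omega> (r div 2 + 1) (s div 2 + 1) $$ (r mod 2, s mod 2))"

text \<open>The inverse exists for all positive \<open>c\<close>; see \<open>M_Green_inverse\<close> below.\<close>

definition M_Green ::
    "nat \<Rightarrow> (nat \<Rightarrow> real) \<Rightarrow> (nat \<Rightarrow> real) \<Rightarrow> real \<Rightarrow> complex mat" where
  "M_Green n x c \<omega> = the (mat_inverse (M_mat n x c \<omega>))"

fun Q_seq :: "(nat \<Rightarrow> real) \<Rightarrow> (nat \<Rightarrow> real) \<Rightarrow> real \<Rightarrow> nat \<Rightarrow> complex" where
  "Q_seq x c \<omega> 0 = 0"
| "Q_seq x c \<omega> (Suc 0) = complex_of_real (q_coeff c 1) / sigma x c \<omega> 1"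
| "Q_seq x c \<omega> (Suc (Suc j)) =
     (complex_of_real (q_coeff c (j + 2)) + Q_seq x c \<omega> (j + 1)) /
     (sigma x c \<omega> (j + 2) * (1 + complex_of_real (q_coeff c (j + 2)) * Q_seq x c \<omega> (j + 1)))"

definition entry :: "'a mat \<Rightarrow> nat \<Rightarrow> nat \<Rightarrow> 'a" where
  \<comment> \<open>1-based indexing\<close>
  "entry A i j = A $$ (i - 1, j - 1)"

lemma M_mat_entries:
  assumes "j < n" "k < n"
  shows "M_mat n x c \<omega> $$ (2 * j, 2 * k) =
           (if k = j then complex_of_real (q_coeff c (j + 1)) else 0)"
    and "M_mat n x c \<omega> $$ (2 * j, 2 * k + 1) =
           (if k = j then complex_of_real (sqrt (1 - (q_coeff c (j + 1))\<^sup>2))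
            else if j = k + 1 then - (1 / sqrt_sigma x c \<omega> j) else 0)"
    and "M_mat n x c \<omega> $$ (2 * j + 1, 2 * k) =
           (if k = j then complex_of_real (sqrt (1 - (q_coeff c (j + 1))\<^sup>2))
            else if k = j + 1 then - (1 / sqrt_sigma x c \<omega> (j + 1)) else 0)"
    and "M_mat n x c \<omega> $$ (2 * j + 1, 2 * k + 1) =
           (if k = j then - complex_of_real (q_coeff c (j + 1)) else 0)"
  using assms
  by (auto simp: M_mat_def M_block_def W_block_def N_block_def mat_of_rows_list_def
      transpose_mat_def)

lemma sum_pairs:
  fixes f :: "nat \<Rightarrow> 'a::comm_monoid_add"
  shows "(\<Sum>s\<in>{0..<2 * n}. f s) = (\<Sum>k\<in>{0..<n}. f (2 * k) + f (2 * k + 1))"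
  by (induction n) (simp_all add: add.assoc)

lemma M_mat_mult_vec:
  assumes v: "v \<in> carrier_vec (2 * n)" and j: "j < n"
  shows "(M_mat n x c \<omega> *\<^sub>v v) $ (2 * j) =
           complex_of_real (q_coeff c (j + 1)) * v $ (2 * j)
           + complex_of_real (sqrt (1 - (q_coeff c (j + 1))\<^sup>2)) * v $ (2 * j + 1)
           - (if j = 0 then 0 else v $ (2 * (j - 1) + 1) / sqrt_sigma x c \<omega> j)" (is ?even)
    and "(M_mat n x c \<omega> *\<^sub>v v) $ (2 * j + 1) =
           complex_of_real (sqrt (1 - (q_coeff c (j + 1))\<^sup>2)) * v $ (2 * j)
           - complex_of_real (q_coeff c (j + 1)) * v $ (2 * j + 1)
           - (if j + 1 = n then 0 else v $ (2 * (j + 1)) / sqrt_sigma x c \<omega> (j + 1))" (is ?odd)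
proof -
  let ?M = "M_mat n x c \<omega>"
  let ?q = "complex_of_real (q_coeff c (j + 1))"
  let ?s = "complex_of_real (sqrt (1 - (q_coeff c (j + 1))\<^sup>2))"
  have dim: "dim_row ?M = 2 * n" "dim_col ?M = 2 * n" by (simp_all add: M_mat_def)
  have row: "(?M *\<^sub>v v) $ r =
      (\<Sum>k\<in>{0..<n}. ?M $$ (r, 2 * k) * v $ (2 * k) + ?M $$ (r, 2 * k + 1) * v $ (2 * k + 1))"
    if "r < 2 * n" for r
  proof -
    have "(?M *\<^sub>v v) $ r = (\<Sum>s\<in>{0..<2 * n}. ?M $$ (r, s) * v $ s)"
      using that v dim by (auto simp: scalar_prod_def intro!: sum.cong)
    then show ?thesis by (simp only: sum_pairs)
  qed
  have "(?M *\<^sub>v v) $ (2 * j) =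
      (\<Sum>k\<in>{0..<n}. (if k = j then ?q * v $ (2 * j) + ?s * v $ (2 * j + 1) else 0)
        + (if k = j - 1 then (if j = 0 then 0 else - (v $ (2 * (j - 1) + 1) / sqrt_sigma x c \<omega> j))
           else 0))"
    proof (subst row)
    show "2 * j < 2 * n" using j by simp
  qed (rule sum.cong[OF refl], use j in \<open>auto simp: M_mat_entries[OF j, simplified]\<close>)
  also have "\<dots> = ?q * v $ (2 * j) + ?s * v $ (2 * j + 1)
      - (if j = 0 then 0 else v $ (2 * (j - 1) + 1) / sqrt_sigma x c \<omega> j)"
    using j by (auto simp: sum.distrib)
  finally show ?even .
  have "(?M *\<^sub>v v) $ (2 * j + 1) =
      (\<Sum>k\<in>{0..<n}. (if k = j then ?s * v $ (2 * j) - ?q * v $ (2 * j + 1) else 0)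
        + (if k = j + 1 then - (v $ (2 * (j + 1)) / sqrt_sigma x c \<omega> (j + 1)) else 0))"
    proof (subst row)
    show "2 * j + 1 < 2 * n" using j by simp
  qed (rule sum.cong[OF refl], use j in \<open>auto simp: M_mat_entries[OF j, simplified]\<close>)
  also have "\<dots> = ?s * v $ (2 * j) - ?q * v $ (2 * j + 1)
      - (if j + 1 = n then 0 else v $ (2 * (j + 1)) / sqrt_sigma x c \<omega> (j + 1))"
    using j by (auto simp: sum.distrib)
  finally show ?odd .
qed

lemma norm_sqrt_sigma: "cmod (sqrt_sigma x c \<omega> j) = 1"
  by (simp add: sqrt_sigma_def norm_exp_eq_Re)

lemma q_coeff_sq_less_1:
  assumes "0 < c j" "0 < c (j + 1)"
  shows "(q_coeff c j)\<^sup>2 < 1"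
proof -
  have "\<bar>q_coeff c j\<bar> < 1"
    using assms by (simp add: q_coeff_def abs_less_iff divide_less_eq less_divide_eq)
  then show ?thesis by (simp add: abs_square_less_1)
qed

lemma reflection_norm:
  fixes a b :: complex
  assumes "q\<^sup>2 + s\<^sup>2 = 1"
  shows "(cmod (complex_of_real q * a + complex_of_real s * b))\<^sup>2
       + (cmod (complex_of_real s * a - complex_of_real q * b))\<^sup>2 = (cmod a)\<^sup>2 + (cmod b)\<^sup>2"
proof -
  have "(cmod (complex_of_real q * a + complex_of_real s * b))\<^sup>2
       + (cmod (complex_of_real s * a - complex_of_real q * b))\<^sup>2
       = (q\<^sup>2 + s\<^sup>2) * ((cmod a)\<^sup>2 + (cmod b)\<^sup>2)"
    by (simp add: cmod_power2, simp add: power2_eq_square algebra_simps)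
  then show ?thesis using assms by simp
qed

lemma M_mat_kernel:
  assumes c: "\<And>j. 1 \<le> j \<Longrightarrow> j \<le> n + 1 \<Longrightarrow> 0 < c j"
    and v: "v \<in> carrier_vec (2 * n)" and ker: "M_mat n x c \<omega> *\<^sub>v v = 0\<^sub>v (2 * n)"
  shows "v = 0\<^sub>v (2 * n)"
proof -
  define A where "A j = (if j < n then v $ (2 * j) else 0)" for j
  define B where "B j = (if j = 0 then 0 else v $ (2 * (j - 1) + 1))" for j
  let ?q = "\<lambda>j. q_coeff c (j + 1)" and ?s = "\<lambda>j. sqrt (1 - (q_coeff c (j + 1))\<^sup>2)"
  have q: "(?q j)\<^sup>2 < 1" if "j < n" for j
    using c that by (intro q_coeff_sq_less_1) auto
  have e1: "complex_of_real (?q j) * A j + complex_of_real (?s j) * B (j + 1)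
      = B j / sqrt_sigma x c \<omega> j" if "j < n" for j
  proof -
    have "(M_mat n x c \<omega> *\<^sub>v v) $ (2 * j) = 0" using ker that by simp
    then show ?thesis unfolding M_mat_mult_vec(1)[OF v that] using that
      by (auto simp: A_def B_def split: if_splits)
  qed
  have e2: "complex_of_real (?s j) * A j - complex_of_real (?q j) * B (j + 1)
      = A (j + 1) / sqrt_sigma x c \<omega> (j + 1)" if "j < n" for j
  proof -
    have "(M_mat n x c \<omega> *\<^sub>v v) $ (2 * j + 1) = 0" using ker that by simp
    then show ?thesis unfolding M_mat_mult_vec(2)[OF v that] using that
      by (auto simp: A_def B_def split: if_splits)
  qed
  have flux: "(cmod (A j))\<^sup>2 - (cmod (B j))\<^sup>2 = (cmod (A 0))\<^sup>2" if "j \<le> n" for j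
    using that
  proof (induction j)
    case 0
    show ?case by (simp add: B_def)
  next
    case (Suc j)
    then have j: "j < n" by simp
    have "(cmod (B j / sqrt_sigma x c \<omega> j))\<^sup>2 + (cmod (A (j + 1) / sqrt_sigma x c \<omega> (j + 1)))\<^sup>2
        = (cmod (A j))\<^sup>2 + (cmod (B (j + 1)))\<^sup>2"
      unfolding e1[OF j, symmetric] e2[OF j, symmetric]
      using q[OF j] by (intro reflection_norm) simp
    then show ?case using Suc by (simp add: norm_divide norm_sqrt_sigma)
  qed
  have "- (cmod (B n))\<^sup>2 = (cmod (A 0))\<^sup>2"
    using flux[of n] by (simp add: A_def)
  then have "(cmod (A 0))\<^sup>2 \<le> 0" by (metis neg_le_0_iff_le zero_le_power2)
  then have A0: "A 0 = 0" by simp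
  have zero: "A j = 0 \<and> B j = 0" if "j \<le> n" for j
    using that
  proof (induction j)
    case 0
    show ?case using A0 by (simp add: B_def)
  next
    case (Suc j)
    then have j: "j < n" and IH: "A j = 0" "B j = 0" by auto
    have "complex_of_real (?s j) \<noteq> 0" using q[OF j] by simp
    then have B1: "B (j + 1) = 0" using e1[OF j] IH by simp
    have "sqrt_sigma x c \<omega> (j + 1) \<noteq> 0" by (simp add: sqrt_sigma_def)
    then have "A (j + 1) = 0" using e2[OF j] IH B1 by simp
    then show ?case using B1 by simp
  qed
  have "v $ r = 0" if r: "r < 2 * n" for r
  proof (cases "even r")
    case True
    then obtain j where "r = 2 * j" by (elim evenE)
    then show ?thesis using zero[of j] r by (simp add: A_def)
  next
    case False
    then obtain j where "r = 2 * j + 1" by (elim oddE)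
    then show ?thesis using zero[of "j + 1"] r by (simp add: B_def)
  qed
  then show ?thesis using v by auto
qed

lemma M_Green_inverse:
  assumes "\<And>j. 1 \<le> j \<Longrightarrow> j \<le> n + 1 \<Longrightarrow> 0 < c j"
  shows "M_Green n x c \<omega> \<in> carrier_mat (2 * n) (2 * n)"
    and "M_mat n x c \<omega> * M_Green n x c \<omega> = 1\<^sub>m (2 * n)"
    and "M_Green n x c \<omega> * M_mat n x c \<omega> = 1\<^sub>m (2 * n)"
proof -
  let ?M = "M_mat n x c \<omega>"
  have carrier: "?M \<in> carrier_mat (2 * n) (2 * n)" by (simp add: M_mat_def)
  have "det ?M \<noteq> 0"
  proof
    assume "det ?M = 0"
    then obtain v where "v \<in> carrier_vec (2 * n)" "v \<noteq> 0\<^sub>v (2 * n)" "?M *\<^sub>v v = 0\<^sub>v (2 * n)"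
      using det_0_iff_vec_prod_zero_field[OF carrier] by auto
    with M_mat_kernel[of n c v x \<omega>] assms show False by blast
  qed
  then have "?M \<in> Units (ring_mat TYPE(complex) (2 * n) ())"
    by (rule det_non_zero_imp_unit[OF carrier])
  then have "mat_inverse ?M = Some (M_Green n x c \<omega>)"
    using mat_inverse(1)[OF carrier] unfolding M_Green_def by fastforce
  from mat_inverse(2)[OF carrier this]
  show "M_Green n x c \<omega> \<in> carrier_mat (2 * n) (2 * n)"
    and "?M * M_Green n x c \<omega> = 1\<^sub>m (2 * n)"
    and "M_Green n x c \<omega> * ?M = 1\<^sub>m (2 * n)" by auto
qed

end

theory Submission
  imports Defs
begin

text \<open>Write \<open>D\<^sub>l = 1 + q\<^sub>l Q\<^sub>l\<^sub>-\<^sub>1\<close>, let \<open>P\<^sub>j\<close> be the product of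
  \<open>s\<^sub>l / (D\<^sub>l \<surd>\<sigma>\<^sub>l\<^sub>-\<^sub>1)\<close> over \<open>j \<le> l \<le> n\<close>, where
  \<open>s\<^sub>l = sqrt (1 - q\<^sub>l\<^sup>2)\<close>, and put \<open>a\<^sub>j = \<surd>\<sigma>\<^sub>j\<^sub>-\<^sub>1 P\<^sub>j\<close> and
  \<open>b\<^sub>j = - \<sigma>\<^sub>j Q\<^sub>j P\<^sub>j\<^sub>+\<^sub>1\<close>. Since \<open>\<sigma>\<^sub>j Q\<^sub>j D\<^sub>j = q\<^sub>j + Q\<^sub>j\<^sub>-\<^sub>1\<close>, one has
  \<open>q\<^sub>j a\<^sub>j + s\<^sub>j b\<^sub>j = b\<^sub>j\<^sub>-\<^sub>1 / \<surd>\<sigma>\<^sub>j\<^sub>-\<^sub>1\<close> and \<open>s\<^sub>j a\<^sub>j - q\<^sub>j b\<^sub>j = P\<^sub>j\<^sub>+\<^sub>1\<close>, so the vector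
  \<open>(a\<^sub>1, b\<^sub>1, \<dots>, a\<^sub>n, b\<^sub>n)\<close> is mapped to the last unit vector and is the last column of the
  inverse. The denominators do not vanish because \<open>\<bar>Q\<^sub>j\<bar> < 1\<close>: the map
  \<open>z \<mapsto> (q + z) / (1 + q z)\<close> preserves the unit disc for \<open>-1 < q < 1\<close>.\<close>

section \<open>The sequence \<open>Q_seq\<close> stays in the open unit disc\<close>

lemma disc_automorphism:
  fixes z :: complex
  assumes "q\<^sup>2 < 1" "cmod z < 1"
  shows "cmod (of_real q + z) < cmod (1 + of_real q * z)"
proof -
  have "(cmod (1 + of_real q * z))\<^sup>2 - (cmod (of_real q + z))\<^sup>2 = (1 - q\<^sup>2) * (1 - (cmod z)\<^sup>2)"
    by (simp add: cmod_power2, simp add: power2_eq_square algebra_simps)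
  moreover have "(cmod z)\<^sup>2 < 1"
    using assms(2) by (simp add: abs_square_less_1)
  then have "(1 - q\<^sup>2) * (1 - (cmod z)\<^sup>2) > 0"
    using assms(1) by simp
  ultimately have "(cmod (of_real q + z))\<^sup>2 < (cmod (1 + of_real q * z))\<^sup>2"
    by linarith
  then show ?thesis
    by (rule power2_less_imp_less) simp
qed

lemma sqrt_sigma_square: "sqrt_sigma x c \<omega> j * sqrt_sigma x c \<omega> j = sigma x c \<omega> j"
  by (simp add: sqrt_sigma_def sigma_def algebra_simps flip: exp_add)

lemma sqrt_sigma_nonzero: "sqrt_sigma x c \<omega> j \<noteq> 0"
  by (simp add: sqrt_sigma_def)

lemma sigma_nonzero: "sigma x c \<omega> j \<noteq> 0"
  by (simp add: sigma_def)

lemma norm_sigma: "cmod (sigma x c \<omega> j) = 1"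
  by (simp flip: sqrt_sigma_square add: norm_mult norm_sqrt_sigma)

text \<open>Since \<open>Q_seq\<close> is 0 at index 0, its separate initial value is an instance of
  the general recursion, so later arguments need no case for the first block.\<close>

lemma Q_seq_Suc:
  "Q_seq x c \<omega> (Suc j) =
     (complex_of_real (q_coeff c (Suc j)) + Q_seq x c \<omega> j) /
     (sigma x c \<omega> (Suc j) * (1 + complex_of_real (q_coeff c (Suc j)) * Q_seq x c \<omega> j))"
  by (cases j) simp_all

lemma norm_Q_seq_less_1:
  assumes "\<And>j. 1 \<le> j \<Longrightarrow> j \<le> n + 1 \<Longrightarrow> 0 < c j" "j \<le> n"
  shows "cmod (Q_seq x c \<omega> j) < 1"
  using assms(2)
proof (induction j)
  case (Suc j)
  have "(q_coeff c (Suc j))\<^sup>2 < 1"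
    using assms(1) Suc.prems by (intro q_coeff_sq_less_1) auto
  then have "cmod (q_coeff c (Suc j) + Q_seq x c \<omega> j)
      < cmod (1 + q_coeff c (Suc j) * Q_seq x c \<omega> j)"
    using Suc by (intro disc_automorphism) auto
  then show ?case
    unfolding Q_seq_Suc
    by (simp add: norm_divide norm_mult norm_sigma divide_less_eq)
qed simp

text \<open>\<open>disc_automorphism\<close> compares two moduli without dividing, so its strict
  inequality also excludes a zero denominator: the larger modulus exceeds a nonnegative
  number.\<close>

lemma Q_seq_denominator_nonzero:
  assumes "\<And>j. 1 \<le> j \<Longrightarrow> j \<le> n + 1 \<Longrightarrow> 0 < c j" "j < n"
  shows "1 + complex_of_real (q_coeff c (Suc j)) * Q_seq x c \<omega> j \<noteq> 0"
proof -
  have "(q_coeff c (Suc j))\<^sup>2 < 1"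
    using assms by (intro q_coeff_sq_less_1) auto
  then have "cmod (q_coeff c (Suc j) + Q_seq x c \<omega> j)
      < cmod (1 + q_coeff c (Suc j) * Q_seq x c \<omega> j)"
    using norm_Q_seq_less_1[where n = n and j = j, OF assms(1)] assms(2) by (intro disc_automorphism) auto
  then show ?thesis
    by auto
qed

section \<open>An explicit solution of the linear system for the last column\<close>

definition transfer_prod ::
    "nat \<Rightarrow> (nat \<Rightarrow> real) \<Rightarrow> (nat \<Rightarrow> real) \<Rightarrow> real \<Rightarrow> nat \<Rightarrow> complex" where
  "transfer_prod n x c \<omega> j = (\<Prod>l = j..n.
     complex_of_real (sqrt (1 - (q_coeff c l)\<^sup>2)) /
     ((1 + complex_of_real (q_coeff c l) * Q_seq x c \<omega> (l - 1)) * sqrt_sigma x c \<omega> (l - 1)))"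

lemma transfer_prod_rec:
  assumes "j < n"
  shows "transfer_prod n x c \<omega> (Suc j) =
     complex_of_real (sqrt (1 - (q_coeff c (Suc j))\<^sup>2)) /
     ((1 + complex_of_real (q_coeff c (Suc j)) * Q_seq x c \<omega> j) * sqrt_sigma x c \<omega> j)
     * transfer_prod n x c \<omega> (Suc (Suc j))"
  using assms by (simp add: transfer_prod_def prod.atLeast_Suc_atMost)

lemma norm_transfer_prod:
  "cmod (transfer_prod n x c \<omega> j) =
     cmod (\<Prod>l = j..n. complex_of_real (sqrt (1 - (q_coeff c l)\<^sup>2)) /
       (1 + complex_of_real (q_coeff c l) * Q_seq x c \<omega> (l - 1)))"
  by (simp add: transfer_prod_def prod_norm [symmetric] norm_divide norm_mult norm_sqrt_sigma)

text \<open>The index \<open>r\<close> counts from 0: row \<open>2 * j\<close> holds \<open>a\<close> and row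
  \<open>2 * j + 1\<close> holds \<open>b\<close>, both with the subscript \<open>j + 1\<close>.\<close>

definition last_column ::
    "nat \<Rightarrow> (nat \<Rightarrow> real) \<Rightarrow> (nat \<Rightarrow> real) \<Rightarrow> real \<Rightarrow> complex vec" where
  "last_column n x c \<omega> = vec (2 * n) (\<lambda>r.
     if even r then sqrt_sigma x c \<omega> (r div 2) * transfer_prod n x c \<omega> (r div 2 + 1)
     else - (sigma x c \<omega> (r div 2 + 1) * Q_seq x c \<omega> (r div 2 + 1)
             * transfer_prod n x c \<omega> (r div 2 + 2)))"

lemma last_column_carrier: "last_column n x c \<omega> \<in> carrier_vec (2 * n)"
  by (simp add: last_column_def)

lemma last_column_nth:
  assumes "j < n"
  shows "last_column n x c \<omega> $ (2 * j) = sqrt_sigma x c \<omega> j * transfer_prod n x c \<omega> (Suc j)"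
    and "last_column n x c \<omega> $ (2 * j + 1) =
      - (sigma x c \<omega> (Suc j) * Q_seq x c \<omega> (Suc j) * transfer_prod n x c \<omega> (Suc (Suc j)))"
  using assms by (simp_all add: last_column_def)

lemma M_mat_last_column:
  assumes c: "\<And>j. 1 \<le> j \<Longrightarrow> j \<le> n + 1 \<Longrightarrow> 0 < c j" and n: "0 < n"
  shows "M_mat n x c \<omega> *\<^sub>v last_column n x c \<omega> = unit_vec (2 * n) (2 * n - 1)"
proof -
  let ?v = "last_column n x c \<omega>"
  let ?P = "transfer_prod n x c \<omega>"
  have rows: "(M_mat n x c \<omega> *\<^sub>v ?v) $ (2 * j) = 0"
    "(M_mat n x c \<omega> *\<^sub>v ?v) $ (2 * j + 1) = (if j + 1 = n then 1 else 0)" if j: "j < n" for j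
  proof -
    define q s Q D where "q = complex_of_real (q_coeff c (Suc j))"
      and "s = complex_of_real (sqrt (1 - (q_coeff c (Suc j))\<^sup>2))"
      and "Q = Q_seq x c \<omega> j" and "D = 1 + q * Q"
    have "(q_coeff c (Suc j))\<^sup>2 < 1"
      using c j by (intro q_coeff_sq_less_1) auto
    then have s2: "s * s = 1 - q * q"
      unfolding s_def q_def of_real_mult[symmetric] by (simp add: power2_eq_square)
    have D: "D \<noteq> 0"
      using Q_seq_denominator_nonzero[OF c j] by (simp add: D_def q_def Q_def)
    have a: "?v $ (2 * j) = s / D * ?P (Suc (Suc j))"
      unfolding last_column_nth(1)[OF j] transfer_prod_rec[OF j]
      by (simp add: s_def D_def q_def Q_def sqrt_sigma_nonzero)
    have b: "?v $ (2 * j + 1) = - ((q + Q) / D * ?P (Suc (Suc j)))"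
      unfolding last_column_nth(2)[OF j] Q_seq_Suc
      by (simp add: D_def q_def Q_def sigma_nonzero)
    \<comment> \<open>The coupling to the preceding block. In the first block there is none, which
      fits the formula because Q = 0 there. Otherwise dividing \<open>sigma\<close> by its square
      root leaves one root, which is absorbed by the other expression for the entry in
      \<open>a\<close>.\<close>
    have b': "(if j = 0 then 0 else ?v $ (2 * (j - 1) + 1) / sqrt_sigma x c \<omega> j)
        = - (Q * (s / D * ?P (Suc (Suc j))))"
    proof (cases j)
      case 0
      then show ?thesis by (simp add: Q_def)
    next
      case (Suc i)
      then have "?v $ (2 * (j - 1) + 1) = - (sigma x c \<omega> j * Q * ?P (Suc j))"
        using last_column_nth(2)[of i n x c \<omega>] j by (simp add: Q_def)
      moreover have "sqrt_sigma x c \<omega> j * ?P (Suc j) = s / D * ?P (Suc (Suc j))"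
        using a unfolding last_column_nth(1)[OF j] .
      ultimately show ?thesis
        using Suc by (simp add: sqrt_sigma_nonzero field_simps flip: sqrt_sigma_square)
    qed
    have a': "(if j + 1 = n then 0 else ?v $ (2 * (j + 1)) / sqrt_sigma x c \<omega> (j + 1))
        = ?P (Suc (Suc j)) - (if j + 1 = n then 1 else 0)"
    \<comment> \<open>In the last block the product starts at n + 1, so it is empty and equals 1.
      The missing coupling thus produces the entry 1 of the unit vector.\<close>
    proof (cases "j + 1 = n")
      case True
      then show ?thesis by (simp add: transfer_prod_def)
    next
      case False
      then show ?thesis
        using last_column_nth(1)[of "j + 1" n x c \<omega>] j by (simp add: sqrt_sigma_nonzero)
    qed
    \<comment> \<open>Up to the common product the three terms are q s / D, - s (q + Q) / D and Q s
      / D.\<close>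
    show "(M_mat n x c \<omega> *\<^sub>v ?v) $ (2 * j) = 0"
      unfolding M_mat_mult_vec(1)[OF last_column_carrier j] a b b'
      using D by (simp add: q_def[symmetric] s_def[symmetric] field_simps)
    have "s * (s / D * ?P (Suc (Suc j))) + q * ((q + Q) / D * ?P (Suc (Suc j)))
        = (s * s + q * q + q * Q) / D * ?P (Suc (Suc j))"
      by (simp add: algebra_simps add_divide_distrib)
    also have "\<dots> = ?P (Suc (Suc j))"
      using D by (simp add: s2 D_def)
    finally show "(M_mat n x c \<omega> *\<^sub>v ?v) $ (2 * j + 1) = (if j + 1 = n then 1 else 0)"
      unfolding M_mat_mult_vec(2)[OF last_column_carrier j] a b a'
      by (simp add: q_def[symmetric] s_def[symmetric])
  qed
  show ?thesis
  proof (rule eq_vecI)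
    fix r assume "r < dim_vec (unit_vec (2 * n) (2 * n - 1) :: complex vec)"
    then have r: "r < 2 * n" by simp
    show "(M_mat n x c \<omega> *\<^sub>v ?v) $ r = unit_vec (2 * n) (2 * n - 1) $ r"
    proof (cases "even r")
      case True
      then obtain j where "r = 2 * j" by (elim evenE)
      \<comment> \<open>By parity r differs from 2 n - 1, so the unit vector is 0 at r.\<close>
      then show ?thesis using rows(1)[of j] r n by (auto; presburger)
    next
      case False
      then obtain j where "r = 2 * j + 1" by (elim oddE)
      then show ?thesis using rows(2)[of j] r n by auto
    qed
  qed (simp add: M_mat_def)
qed

section \<open>From the solution to the entries of the inverse\<close>

lemma col_M_Green:
  assumes "\<And>j. 1 \<le> j \<Longrightarrow> j \<le> n + 1 \<Longrightarrow> 0 < c j" "0 < n"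
  shows "col (M_Green n x c \<omega>) (2 * n - 1) = last_column n x c \<omega>"
proof -
  note G = M_Green_inverse[of n c x \<omega>, OF assms(1)]
  have M: "M_mat n x c \<omega> \<in> carrier_mat (2 * n) (2 * n)"
    by (simp add: M_mat_def)
  have "last_column n x c \<omega> = (M_Green n x c \<omega> * M_mat n x c \<omega>) *\<^sub>v last_column n x c \<omega>"
    using G last_column_carrier by simp
  also have "\<dots> = M_Green n x c \<omega> *\<^sub>v unit_vec (2 * n) (2 * n - 1)"
    using assms by (simp add: assoc_mult_mat_vec[OF G(1) M last_column_carrier] M_mat_last_column)
  also have "\<dots> = col (M_Green n x c \<omega>) (2 * n - 1)"
    using G(1) assms(2) by (intro eq_vecI) (auto simp: scalar_prod_right_unit)
  finally show ?thesis by simp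
qed

text \<open>Counted from 1, row 2 j closes block j and row 2 j + 1 opens block j + 1. Both carry the
  same product, so for 0 < j < n their moduli differ only by the factor |Q_j|.\<close>

lemma entry_M_Green:
  assumes "\<And>j. 1 \<le> j \<Longrightarrow> j \<le> n + 1 \<Longrightarrow> 0 < c j"
  shows entry_M_Green_odd: "j < n \<Longrightarrow> entry (M_Green n x c \<omega>) (2 * j + 1) (2 * n) =
      sqrt_sigma x c \<omega> j * transfer_prod n x c \<omega> (Suc j)"
    and entry_M_Green_even: "0 < j \<Longrightarrow> j \<le> n \<Longrightarrow> entry (M_Green n x c \<omega>) (2 * j) (2 * n) =
      - (sigma x c \<omega> j * Q_seq x c \<omega> j * transfer_prod n x c \<omega> (Suc j))"
proof -
  note G = M_Green_inverse(1)[of n c x \<omega>, OF assms]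
  have *: "entry (M_Green n x c \<omega>) (r + 1) (2 * n) = last_column n x c \<omega> $ r" if "r < 2 * n" for r
    using that G col_M_Green[of n c x \<omega>, OF assms, symmetric] by (simp add: entry_def)
  show "entry (M_Green n x c \<omega>) (2 * j + 1) (2 * n) =
      sqrt_sigma x c \<omega> j * transfer_prod n x c \<omega> (Suc j)" if "j < n"
    using *[of "2 * j"] last_column_nth(1)[OF that] that by simp
  show "entry (M_Green n x c \<omega>) (2 * j) (2 * n) =
      - (sigma x c \<omega> j * Q_seq x c \<omega> j * transfer_prod n x c \<omega> (Suc j))" if "0 < j" "j \<le> n"
    using *[of "2 * (j - 1) + 1"] last_column_nth(2)[of "j - 1" n x c \<omega>] that
    by (cases j) auto
qed

theorem corollary8:
  fixes n :: nat and x c :: "nat \<Rightarrow> real" and \<omega> \<omega>\<^sub>0 :: real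
  assumes "n \<ge> 2"
    and "x 0 = -1" and "x (n + 1) = 1" and "\<forall>j\<in>{0..n}. x j < x (j + 1)"
    and "\<And>j. 1 \<le> j \<Longrightarrow> j \<le> n + 1 \<Longrightarrow> 0 < c j"
    and "\<omega>\<^sub>0 > 0" and "\<omega> \<ge> \<omega>\<^sub>0"
  shows "(\<forall>i\<in>{1..2 * n}. entry (M_Green n x c \<omega>) i (2 * n) =
            (-1) ^ (i + 1) *
            (\<Prod>l = (i + 2) div 2..n.
               complex_of_real (sqrt (1 - (q_coeff c l)\<^sup>2)) /
               ((1 + complex_of_real (q_coeff c l) * Q_seq x c \<omega> (l - 1))
                 * sqrt_sigma x c \<omega> (l - 1))) *
            (if even i then sigma x c \<omega> (i div 2) * Q_seq x c \<omega> (i div 2)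
             else sqrt_sigma x c \<omega> ((i - 1) div 2)))
       \<and> (\<forall>m\<in>{1..n}. cmod (entry (M_Green n x c \<omega>) (2 * n - 2 * m + 1) (2 * n)) =
            cmod (\<Prod>l = n - m + 1..n.
               complex_of_real (sqrt (1 - (q_coeff c l)\<^sup>2)) /
               (1 + complex_of_real (q_coeff c l) * Q_seq x c \<omega> (l - 1))))
       \<and> cmod (entry (M_Green n x c \<omega>) (2 * n) (2 * n)) = cmod (Q_seq x c \<omega> n)
       \<and> (\<forall>m\<in>{1..n - 1}. cmod (entry (M_Green n x c \<omega>) (2 * n - 2 * m) (2 * n)) =
            cmod (entry (M_Green n x c \<omega>) (2 * n - 2 * m + 1) (2 * n))
            * cmod (Q_seq x c \<omega> (n - m)))"
proof (intro conjI ballI)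
  note odd = entry_M_Green_odd[of n c _ x \<omega>, OF assms(5)]
  note even = entry_M_Green_even[of n c _ x \<omega>, OF assms(5)]
  have norm_odd: "cmod (entry (M_Green n x c \<omega>) (2 * n - 2 * m + 1) (2 * n)) =
      cmod (transfer_prod n x c \<omega> (n - m + 1))" if "m \<in> {1..n}" for m
    using odd[of "n - m"] that by (simp add: norm_mult norm_sqrt_sigma diff_mult_distrib2)
  {
    fix i assume i: "i \<in> {1..2 * n}"
    show "entry (M_Green n x c \<omega>) i (2 * n) =
            (-1) ^ (i + 1) *
            (\<Prod>l = (i + 2) div 2..n.
               complex_of_real (sqrt (1 - (q_coeff c l)\<^sup>2)) /
               ((1 + complex_of_real (q_coeff c l) * Q_seq x c \<omega> (l - 1))
                 * sqrt_sigma x c \<omega> (l - 1))) *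
            (if even i then sigma x c \<omega> (i div 2) * Q_seq x c \<omega> (i div 2)
             else sqrt_sigma x c \<omega> ((i - 1) div 2))"
      unfolding transfer_prod_def[symmetric]
    proof (cases "even i")
      case True
      then obtain j where "i = 2 * j" by (elim evenE)
      then show "entry (M_Green n x c \<omega>) i (2 * n) =
            (-1) ^ (i + 1) * transfer_prod n x c \<omega> ((i + 2) div 2) *
            (if even i then sigma x c \<omega> (i div 2) * Q_seq x c \<omega> (i div 2)
             else sqrt_sigma x c \<omega> ((i - 1) div 2))"
        using even[of j] i by simp
    next
      case False
      then obtain j where "i = 2 * j + 1" by (elim oddE)
      then show "entry (M_Green n x c \<omega>) i (2 * n) =
            (-1) ^ (i + 1) * transfer_prod n x c \<omega> ((i + 2) div 2) *
            (if even i then sigma x c \<omega> (i div 2) * Q_seq x c \<omega> (i div 2)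
             else sqrt_sigma x c \<omega> ((i - 1) div 2))"
        using odd[of j] i by simp
    qed
  next
    fix m assume "m \<in> {1..n}"
    then show "cmod (entry (M_Green n x c \<omega>) (2 * n - 2 * m + 1) (2 * n)) =
            cmod (\<Prod>l = n - m + 1..n.
               complex_of_real (sqrt (1 - (q_coeff c l)\<^sup>2)) /
               (1 + complex_of_real (q_coeff c l) * Q_seq x c \<omega> (l - 1)))"
      by (simp only: norm_odd norm_transfer_prod)
  next
    \<comment> \<open>For j = n the product is empty and only the factors \<open>sigma\<close> and
      \<open>Q_seq\<close> remain.\<close>
    show "cmod (entry (M_Green n x c \<omega>) (2 * n) (2 * n)) = cmod (Q_seq x c \<omega> n)"
      using even[of n] assms(1) by (simp add: norm_mult norm_sigma transfer_prod_def)
  next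
    fix m assume m: "m \<in> {1..n - 1}"
    then have "m \<in> {1..n}" and "m < n" by auto
    then show
      "cmod (entry (M_Green n x c \<omega>) (2 * n - 2 * m) (2 * n)) =
            cmod (entry (M_Green n x c \<omega>) (2 * n - 2 * m + 1) (2 * n))
            * cmod (Q_seq x c \<omega> (n - m))"
      using even[of "n - m"] norm_odd[of m] by (simp add: norm_mult norm_sigma diff_mult_distrib2)
  }
qed

end
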